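(* (a) Let $Q$ denote the quadrilateral with vertices $\mathbf{q}_1=(0,1)$, $\mathbf{q}_2=(0,\frac56)$, $\mathbf{q}_3=(-\frac14,\frac34)$ and $\mathbf{q}_4=(-\frac13,\frac56)$. A centrally symmetric convex decagon $P_{10}$ takes $\mathbf{u}_1=(-1,\frac12)$, $\mathbf{u}_2=(\frac12,1)$, $\mathbf{u}_3=(\frac32,1)$, $\mathbf{u}_4=(2,\frac12)$, $\mathbf{u}_5=(2,0)$, $\mathbf{u}_6=-\mathbf{u}_1$, $\mathbf{u}_7=-\mathbf{u}_2$, $\mathbf{u}_8=-\mathbf{u}_3$, $\mathbf{u}_9=-\mathbf{u}_4$ and $\mathbf{u}_{10}=-\mathbf{u}_5$ as the middle points of its edges if and only if one of its vertices is an interior point of $Q$. (b) Let $Q^*$ denote the quadrilateral with vertices $\mathbf{q}_1=(0,\frac54)$, $\mathbf{q}_2=(\frac16,\frac76)$, $\mathbf{q}_3=(0,1)$ and $\mathbf{q}_4=(-\frac16,\frac76)$. A centrally symmetric convex decagon $P^*_{10}$ takes $\mathbf{u}_1=(\frac12,-1)$, $\mathbf{u}_2=(\frac32,-\frac12)$, $\mathbf{u}_3=(2,0)$, $\mathbf{u}_4=(\frac32,\frac12)$, $\mathbf{u}_5=(\frac12,1)$, $\mathbf{u}_6=-\mathbf{u}_1$, $\mathbf{u}_7=-\mathbf{u}_2$, $\mathbf{u}_8=-\mathbf{u}_3$, $\mathbf{u}_9=-\mathbf{u}_4$ and $\mathbf{u}_{10}=-\mathbf{u}_5$ as the middle points of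 its edges if and only if one of its vertices is an interior point of $Q^*$.
   Context: Everything takes place in the Euclidean plane $\mathbb{E}^2$. A convex decagon is a convex polygon with ten vertices and ten edges. The points $\mathbf{u}_1,\ldots,\mathbf{u}_{10}$ are defined separately in (a) and in (b), as are the points $\mathbf{q}_1,\ldots,\mathbf{q}_4$.
   Formalization: The "if" half, false for an arbitrary centrally symmetric convex decagon with a vertex interior to Q (or Q* ), is stated as: every interior point of Q (or Q* ) is a vertex of some centrally symmetric convex decagon whose edges have the given middle points. *)

theory Defs
  imports "HOL-Analysis.Analysis"
begin

definition convex_decagon :: "(real^2) set \<Rightarrow> bool" where
  "convex_decagon P \<longleftrightarrow>
     polytope P \<and> aff_dim P = 2 \<and>
     card {v. v extreme_point_of P} = 10 \<and> card {e. e edge_of P} = 10"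

definition centrally_symmetric :: "(real^2) set \<Rightarrow> bool" where
  "centrally_symmetric P \<longleftrightarrow> (\<exists>c. (\<lambda>x. 2 *\<^sub>R c - x) ` P = P)"

(* Every edge of a polytope is a nondegenerate closed segment, so for a polytope
   this is the set of the middle points of all its edges. *)
definition edge_midpoints :: "(real^2) set \<Rightarrow> (real^2) set" where
  "edge_midpoints P = {midpoint a b | a b. closed_segment a b edge_of P}"

definition half_midpoints_a :: "(real^2) set" where
  "half_midpoints_a =
     {vector [-1, 1/2], vector [1/2, 1], vector [3/2, 1], vector [2, 1/2], vector [2, 0]}"

definition half_midpoints_b :: "(real^2) set" where
  "half_midpoints_b =
     {vector [1/2, -1], vector [3/2, -1/2], vector [2, 0], vector [3/2, 1/2], vector [1/2, 1]}"

(* The remaining five points are the negatives: u_(i+5) = - u_i. All ten are distinct. *)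
definition midpoints_a :: "(real^2) set" where
  "midpoints_a = half_midpoints_a \<union> uminus ` half_midpoints_a"

definition midpoints_b :: "(real^2) set" where
  "midpoints_b = half_midpoints_b \<union> uminus ` half_midpoints_b"

(* In both cases the four points are in convex position and listed in cyclic order,
   so the quadrilateral with these vertices is their convex hull. *)
definition quadrilateral_a :: "(real^2) set" where
  "quadrilateral_a =
     convex hull {vector [0, 1], vector [0, 5/6], vector [-1/4, 3/4], vector [-1/3, 5/6]}"

definition quadrilateral_b :: "(real^2) set" where
  "quadrilateral_b =
     convex hull {vector [0, 5/4], vector [1/6, 7/6], vector [0, 1], vector [-1/6, 7/6]}"

end

theory Submission
  imports Defs
begin

text \<open>Write the ten prescribed points counterclockwise as \<open>m 0, m 1, \<dots>\<close>, with
  \<open>m (k + 5) = - m k\<close>. They are in strictly convex position. If a polygon has the points \<open>m k\<close>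
  as edge midpoints in this order, each vertex is the reflection of the preceding one in the
  midpoint between them, so one vertex \<open>v\<close> determines all. In both families
  \<open>m 0 - m 1 + m 2 - m 3 + m 4 = 0\<close>; therefore five reflections take \<open>v\<close> to \<open>- v\<close>, and the closed
  chain of vertices always exists and is symmetric about the origin. What remains is convexity.

  Necessity: let \<open>P\<close> be a polygon whose set of edge midpoints is the given one. For two cyclically
  consecutive midpoints \<open>p\<close>, \<open>q\<close> all other midpoints are on one side of the line \<open>p q\<close>. The edge
  through \<open>p\<close> has an endpoint on the other side. A further edge starts there; it cannot
  cross the line \<open>p q\<close>, so its midpoint is none of the other ones, and it is the edge through \<open>q\<close>
  (\<open>vertex_between_consecutive_midpoints\<close>). Hence the edges follow each other in the order of the
  midpoints, and every vertex lies beyond the line through its two neighbouring midpoints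
  (\<open>vertices_from_midpoints\<close>). Up to symmetry these are five inequalities, affine in \<open>v\<close>; one of
  them is redundant and the other four describe the interior of the quadrilateral.

  Sufficiency: if \<open>v\<close> is in the interior of the quadrilateral, all vertices other than the
  endpoints of a side of the chain lie to the left of that side, so the chain is a convex cycle.
  The convex hull of a convex cycle of \<open>n\<close> points has exactly these points as vertices
  and the \<open>n\<close> sides of the cycle as edges (\<open>convex_cycle_polygon\<close>).\<close>

section \<open>Orientation of a triple of points in the plane\<close>

text \<open>Twice the signed area of the triangle \<open>a b c\<close>: positive if and only if the triangle is
  traversed counterclockwise, and zero if and only if the points are collinear.\<close>

definition orient :: "real^2 \<Rightarrow> real^2 \<Rightarrow> real^2 \<Rightarrow> real" where
  "orient a b c = (b$1 - a$1) * (c$2 - a$2) - (b$2 - a$2) * (c$1 - a$1)"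

lemma orient_inner:
  "orient a b x = vector [- (b$2 - a$2), b$1 - a$1] \<bullet> x
     - vector [- (b$2 - a$2), b$1 - a$1] \<bullet> a"
  by (simp add: orient_def inner_vec_def sum_2 algebra_simps)

lemma orient_affine:
  "orient a b ((1 - t) *\<^sub>R x + t *\<^sub>R y) = (1 - t) * orient a b x + t * orient a b y"
  by (simp add: orient_def algebra_simps)

lemma orient_degenerate [simp]: "orient a a x = 0" "orient a x a = 0" "orient x a a = 0"
  by (simp_all add: orient_def)

lemma orient_rotate: "orient a b c = orient b c a"
  by (simp add: orient_def algebra_simps)

lemma orient_uminus [simp]: "orient (- a) (- b) (- c) = orient a b c"
  by (simp add: orient_def algebra_simps)

lemma convex_orient_pos: "convex {x. orient a b x > 0}"
  unfolding orient_inner using convex_halfspace_gt by (simp add: algebra_simps)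

lemma orient_zero_line:
  assumes "a \<noteq> b" "orient a b x = 0"
  obtains t where "x = (1 - t) *\<^sub>R a + t *\<^sub>R b"
proof -
  have eq: "(b$1 - a$1) * (x$2 - a$2) = (b$2 - a$2) * (x$1 - a$1)"
    using assms(2) by (simp add: orient_def)
  show ?thesis
  proof (cases "b$1 = a$1")
    case True
    with assms(1) have ne: "b$2 \<noteq> a$2"
      by (auto simp: vec_eq_iff forall_2)
    define t where "t = (x$2 - a$2) / (b$2 - a$2)"
    have "t * (b$2 - a$2) = x$2 - a$2" using ne by (simp add: t_def)
    moreover have "x$1 = a$1" using True ne eq by simp
    ultimately have "x = (1 - t) *\<^sub>R a + t *\<^sub>R b"
      using True by (simp add: vec_eq_iff forall_2 algebra_simps)
    then show ?thesis by (rule that)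
  next
    case False
    define t where "t = (x$1 - a$1) / (b$1 - a$1)"
    have "t * (b$1 - a$1) = x$1 - a$1" using False by (simp add: t_def)
    moreover have "t * (b$2 - a$2) = x$2 - a$2" using False eq by (simp add: t_def field_simps)
    ultimately have "x = (1 - t) *\<^sub>R a + t *\<^sub>R b"
      by (simp add: vec_eq_iff forall_2 algebra_simps)
    then show ?thesis by (rule that)
  qed
qed

lemma orient_affine_hull:
  assumes "x \<in> affine hull {a, b}"
  shows "orient a b x = 0"
proof -
  obtain u v where "x = u *\<^sub>R a + v *\<^sub>R b" "u + v = 1"
    using assms by (auto simp: affine_hull_2)
  moreover from this have "u = 1 - v" by simp
  ultimately have "x = (1 - v) *\<^sub>R a + v *\<^sub>R b" by simp
  then show ?thesis by (simp add: orient_affine)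
qed

lemma interior_orient_ge:
  assumes "a \<noteq> b"
  shows "interior {x. 0 \<le> orient a b x} = {x. 0 < orient a b x}"
proof -
  let ?n = "vector [- (b$2 - a$2), b$1 - a$1] :: real^2"
  have "?n \<noteq> 0" using assms by (auto simp: vec_eq_iff forall_2)
  then have "interior {x. ?n \<bullet> x \<ge> ?n \<bullet> a} = {x. ?n \<bullet> x > ?n \<bullet> a}" by simp
  then show ?thesis by (simp add: orient_inner)
qed

lemma open_orient_pos: "open {x. 0 < orient a b x}"
  by (cases "a = b") (simp_all flip: interior_orient_ge)

section \<open>The interior of a convex quadrilateral\<close>

lemma in_triangle:
  assumes "orient a b c > 0" "orient a b x \<ge> 0" "orient b c x \<ge> 0" "orient c a x \<ge> 0"
  shows "x \<in> convex hull {a, b, c}"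
proof -
  let ?D = "orient a b c"
  have sum: "orient b c x + orient c a x + orient a b x = ?D"
    by (simp add: orient_def algebra_simps)
  have "?D *\<^sub>R x = orient b c x *\<^sub>R a + orient c a x *\<^sub>R b + orient a b x *\<^sub>R c"
    by (simp add: vec_eq_iff forall_2 orient_def algebra_simps)
  then have "x = (1 / ?D) *\<^sub>R (orient b c x *\<^sub>R a + orient c a x *\<^sub>R b + orient a b x *\<^sub>R c)"
    using assms(1) by (metis divideR_right less_irrefl inverse_eq_divide)
  then have "x = (orient b c x / ?D) *\<^sub>R a + (orient c a x / ?D) *\<^sub>R b + (orient a b x / ?D) *\<^sub>R c"
    by (simp add: scaleR_right_distrib)
  moreover have "orient b c x / ?D + orient c a x / ?D + orient a b x / ?D = 1"
    using assms(1) sum by (simp flip: add_divide_distrib)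
  moreover have "0 \<le> orient b c x / ?D" "0 \<le> orient c a x / ?D" "0 \<le> orient a b x / ?D"
    using assms by simp_all
  ultimately show ?thesis unfolding convex_hull_3 by blast
qed

lemma interior_quadrilateral:
  assumes abc: "orient a b c > 0" and abd: "orient a b d > 0"
    and acd: "orient a c d > 0" and bcd: "orient b c d > 0"
  shows "interior (convex hull {a, b, c, d}) =
    {x. 0 < orient a b x \<and> 0 < orient b c x \<and> 0 < orient c d x \<and> 0 < orient d a x}"
    (is "interior ?Q = ?I")
proof
  have half: "interior ?Q \<subseteq> {x. 0 < orient p q x}"
    if "p \<noteq> q" "{a, b, c, d} \<subseteq> {x. 0 \<le> orient p q x}" for p q
  proof -
    have "convex {x. 0 \<le> orient p q x}"
      unfolding orient_inner using convex_halfspace_ge by (simp add: algebra_simps)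
    then have "?Q \<subseteq> {x. 0 \<le> orient p q x}"
      using that(2) by (simp add: hull_minimal)
    then show ?thesis using interior_mono interior_orient_ge[OF that(1)] by blast
  qed
  have ne: "a \<noteq> b" "b \<noteq> c" "c \<noteq> d" "d \<noteq> a" using assms by auto
  have "orient b c a > 0" "orient c d a > 0" "orient c d b > 0" "orient d a b > 0"
      "orient d a c > 0"
    using assms by (metis orient_rotate)+
  then show "interior ?Q \<subseteq> ?I"
    using half[OF ne(1)] half[OF ne(2)] half[OF ne(3)] half[OF ne(4)] assms by auto
next
  have "?I = {x. 0 < orient a b x} \<inter> {x. 0 < orient b c x} \<inter> {x. 0 < orient c d x}
      \<inter> {x. 0 < orient d a x}"
    by auto
  then have "open ?I" by (simp only: open_Int open_orient_pos)
  moreover have "?I \<subseteq> ?Q"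
  proof
    fix x assume x: "x \<in> ?I"
    \<comment> \<open>The diagonal from \<open>a\<close> to \<open>c\<close> cuts the quadrilateral into two triangles.\<close>
    show "x \<in> ?Q"
    proof (cases "orient a c x \<ge> 0")
      case True
      then have "x \<in> convex hull {a, c, d}"
        using x acd by (intro in_triangle) auto
      moreover have "convex hull {a, c, d} \<subseteq> ?Q" by (rule hull_mono) auto
      ultimately show ?thesis by blast
    next
      case False
      then have "orient c a x \<ge> 0" by (simp add: orient_def algebra_simps)
      then have "x \<in> convex hull {a, b, c}"
        using x abc by (intro in_triangle) auto
      moreover have "convex hull {a, b, c} \<subseteq> ?Q" by (rule hull_mono) auto
      ultimately show ?thesis by blast
    qed
  qed
  ultimately show "?I \<subseteq> interior ?Q" by (rule interior_maximal[rotated])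
qed

section \<open>Edges of a plane polytope and their midpoints\<close>

lemma edge_of_polytope_segment:
  assumes "polytope P" "e edge_of P"
  obtains a b where "e = closed_segment a b" "a \<noteq> b" "a extreme_point_of P" "b extreme_point_of P"
proof -
  have e: "e face_of P" "aff_dim e = 1" using assms(2) by (auto simp: edge_of_def)
  then have "polytope e" using assms(1) face_of_polytope_polytope by blast
  moreover have "e \<noteq> {}" using e(2) by auto
  ultimately obtain a b where ab: "e = closed_segment a b"
    using compact_convex_collinear_segment e(2) collinear_aff_dim
    by (metis order_refl polytope_imp_compact polytope_imp_convex)
  moreover from this have "a \<noteq> b" using e(2) by auto
  moreover have "a extreme_point_of P" "b extreme_point_of P"
    using extreme_point_of_face[OF e(1)] unfolding ab by (auto simp: extreme_point_of_segment)
  ultimately show ?thesis by (rule that)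
qed

lemma midpoint_eq_if_segment_eq:
  fixes a b c d :: "'a::euclidean_space"
  assumes "closed_segment a b = closed_segment c d"
  shows "midpoint a b = midpoint c d"
  using assms by (auto simp: doubleton_eq_iff midpoint_sym)

lemma edge_eq_if_midpoint_in:
  assumes "convex P" "closed_segment a b edge_of P" "f edge_of P" "midpoint a b \<in> f"
  shows "closed_segment a b = f"
proof -
  have e: "closed_segment a b face_of P" "aff_dim (closed_segment a b) = 1"
    and f: "f face_of P" "aff_dim f = 1"
    using assms by (auto simp: edge_of_def)
  have "a \<noteq> b" using e(2) by auto
  then have "midpoint a b \<in> open_segment a b" by simp
  then have "a \<in> f" "b \<in> f"
    using f(1) assms(4) face_of_imp_subset[OF e(1)]
    by (meson ends_in_segment face_ofD subsetD)+
  then have "closed_segment a b \<subseteq> f"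
    using f(1) by (simp add: closed_segment_subset face_of_imp_convex)
  then have "closed_segment a b face_of f"
    using e(1) f(1) face_of_subset face_of_imp_subset by blast
  then show ?thesis
    using face_of_aff_dim_lt[OF face_of_imp_convex[OF f(1)]] e(2) f(2) by fastforce
qed

text \<open>Let \<open>p\<close> and \<open>q\<close> lie on two faces of \<open>P\<close>, neither on the other one's face. A third face that
  has points on both sides of the line \<open>p q\<close> meets this line, and the definition of a face leaves
  no place for the point where it does, unless the third face contains \<open>p\<close> or \<open>q\<close>.\<close>

lemma face_not_crossing:
  assumes E1: "E1 face_of P" "p \<in> E1" "q \<notin> E1"
    and E2: "E2 face_of P" "q \<in> E2" "p \<notin> E2"
    and F: "F face_of P" "p \<notin> F" "q \<notin> F" "v \<in> F" "u \<in> F"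
    and sides: "orient p q v < 0" "orient p q u > 0"
  shows False
proof -
  let ?r = "orient p q v" and ?s = "orient p q u"
  let ?t = "- ?r / (?s - ?r)"
  define y where "y = (1 - ?t) *\<^sub>R v + ?t *\<^sub>R u"
  have "0 \<le> ?t" "?t \<le> 1" using sides by (auto simp: field_simps)
  then have "y \<in> closed_segment v u" unfolding y_def in_segment by blast
  then have yF: "y \<in> F"
    using F closed_segment_subset face_of_imp_convex by blast
  have pq: "p \<noteq> q" using sides by auto
  have "orient p q y = 0"
    unfolding y_def orient_affine using sides by (simp add: field_simps)
  then obtain s where s: "y = (1 - s) *\<^sub>R p + s *\<^sub>R q"
    using orient_zero_line pq by metis
  have P: "p \<in> P" "q \<in> P" "y \<in> P"
    using E1 E2 F(1) yF face_of_imp_subset by blast+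
  consider "s < 0" | "s = 0" | "0 < s" "s < 1" | "s = 1" | "s > 1" by linarith
  then show False
  proof cases
    case 1
    define t where "t = - s / (1 - s)"
    have "(1 - t) * (1 - s) = 1" "(1 - t) * s + t = 0" using 1 by (auto simp: t_def field_simps)
    then have "((1 - t) * (1 - s)) *\<^sub>R p + ((1 - t) * s + t) *\<^sub>R q = p" by simp
    then have "p = (1 - t) *\<^sub>R y + t *\<^sub>R q" unfolding s by (simp add: algebra_simps)
    moreover have "0 < t" "t < 1" using 1 by (auto simp: t_def field_simps)
    moreover have "y \<noteq> q" using yF F(3) by blast
    ultimately have "p \<in> open_segment y q" unfolding in_segment by blast
    then show False using face_ofD[OF E1(1)] E1 P by blast
  next
    case 3
    then have "y \<in> open_segment p q" unfolding in_segment s using pq by blast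
    then show False using face_ofD[OF F(1)] F yF P by blast
  next
    case 5
    have "(1 - 1/s) + (1/s) * (1 - s) = 0" "(1/s) * s = 1" using 5 by (simp_all add: field_simps)
    then have "((1 - 1/s) + (1/s) * (1 - s)) *\<^sub>R p + ((1/s) * s) *\<^sub>R q = q"
      by (simp only: scaleR_zero_left scaleR_one add_0)
    then have "q = (1 - 1/s) *\<^sub>R p + (1/s) *\<^sub>R y"
      unfolding s by (simp only: scaleR_add_left scaleR_add_right scaleR_scaleR add.assoc)
    moreover have "0 < 1/s" "1/s < 1" using 5 by (auto simp: field_simps)
    moreover have "y \<noteq> p" using yF F(2) by blast
    ultimately have "q \<in> open_segment p y" unfolding in_segment by blast
    then show False using face_ofD[OF E2(1)] E2 P by blast
  qed (use s yF F in auto)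
qed

text \<open>The local step of the necessity proof: two midpoints that are consecutive in convex position
  belong to edges with a common vertex, which lies beyond the line joining them.\<close>

lemma vertex_between_consecutive_midpoints:
  assumes P: "polytope P" "aff_dim P = 2"
    and pq: "p \<in> edge_midpoints P" "q \<in> edge_midpoints P" "p \<noteq> q"
    and pos: "\<And>u. u \<in> edge_midpoints P \<Longrightarrow> u \<noteq> p \<Longrightarrow> u \<noteq> q \<Longrightarrow> orient p q u > 0"
  obtains v where "v extreme_point_of P" "orient p q v < 0"
    "\<And>u. closed_segment v (2 *\<^sub>R u - v) edge_of P \<longleftrightarrow> u = p \<or> u = q"
proof -
  have cP: "convex P" using P(1) by (rule polytope_imp_convex)
  have mid2: "closed_segment a (2 *\<^sub>R midpoint a b - a) = closed_segment a b"
    "midpoint a (2 *\<^sub>R u - a) = u" for a b u :: "real^2"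
    by (simp_all add: midpoint_def)
  obtain a b where p: "p = midpoint a b" and E1: "closed_segment a b edge_of P"
    using pq(1) by (auto simp: edge_midpoints_def)
  obtain c d where q: "q = midpoint c d" and E2: "closed_segment c d edge_of P"
    using pq(2) by (auto simp: edge_midpoints_def)
  let ?E1 = "closed_segment a b" and ?E2 = "closed_segment c d"
  have f: "?E1 face_of P" "?E2 face_of P" and d1: "aff_dim ?E1 = 1"
    using E1 E2 by (auto simp: edge_of_def)
  have E12: "?E1 \<noteq> ?E2" using pq(3) p q midpoint_eq_if_segment_eq by blast
  have pE2: "p \<notin> ?E2" using edge_eq_if_midpoint_in[OF cP E1 E2] E12 p by blast
  have qE1: "q \<notin> ?E1" using edge_eq_if_midpoint_in[OF cP E2 E1] E12 q by blast
  have in12: "p \<in> ?E1" "q \<in> ?E2" unfolding p q by simp_all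
  \<comment> \<open>An edge with an endpoint beyond the line can only have one of the two midpoints.\<close>
  have only: "u = p \<or> u = q"
    if F: "closed_segment v (2 *\<^sub>R u - v) edge_of P" and v: "orient p q v < 0" for u v
  proof (rule ccontr)
    assume u: "\<not> ?thesis"
    let ?F = "closed_segment v (2 *\<^sub>R u - v)"
    have mu: "midpoint v (2 *\<^sub>R u - v) = u" by (rule mid2)
    have "u \<in> edge_midpoints P" using F mu unfolding edge_midpoints_def by force
    then have "orient p q u > 0" using pos u by blast
    moreover have "p \<notin> ?F"
      using edge_eq_if_midpoint_in[OF cP E1 F] midpoint_eq_if_segment_eq u p mu by metis
    moreover have "q \<notin> ?F"
      using edge_eq_if_midpoint_in[OF cP E2 F] midpoint_eq_if_segment_eq u q mu by metis
    moreover have "u \<in> ?F" using mu midpoint_in_closed_segment by metis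
    moreover have "?F face_of P" using F by (simp add: edge_of_def)
    ultimately show False
      using face_not_crossing[OF f(1) in12(1) qE1 f(2) in12(2) pE2 _ _ _ _ _ v] by auto
  qed
  have opp: "orient p q a + orient p q b = 0"
  proof -
    have "p = (1 - 1/2) *\<^sub>R a + (1/2) *\<^sub>R b"
      unfolding p by (simp add: midpoint_def algebra_simps)
    then have "orient p q p = (1 - 1/2) * orient p q a + (1/2) * orient p q b"
      by (metis orient_affine)
    then show ?thesis by simp
  qed
  have "orient p q a \<noteq> 0"
  proof
    assume "orient p q a = 0"
    then obtain t where t: "a = (1 - t) *\<^sub>R p + t *\<^sub>R q"
      using orient_zero_line pq(3) by metis
    have "a \<noteq> b" using d1 by auto
    then have "a \<noteq> p" unfolding p by (metis midpoint_eq_endpoint(1))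
    then have "t \<noteq> 0" using t by auto
    then have "(1 - 1/t) + (1/t) * (1 - t) = 0" "(1/t) * t = 1" by (simp_all add: field_simps)
    then have "((1 - 1/t) + (1/t) * (1 - t)) *\<^sub>R p + ((1/t) * t) *\<^sub>R q = q"
      by (simp only: scaleR_zero_left scaleR_one add_0)
    then have "q = (1 - 1/t) *\<^sub>R p + (1/t) *\<^sub>R a"
      unfolding t by (simp only: scaleR_add_left scaleR_add_right scaleR_scaleR add.assoc)
    moreover have "p \<in> affine hull ?E1" using in12(1) by (rule hull_inc)
    moreover have "a \<in> affine hull ?E1" by (rule hull_inc) simp
    ultimately have "q \<in> affine hull ?E1"
      using mem_affine[OF affine_affine_hull] by (metis diff_add_cancel)
    moreover have "q \<in> P" using in12 f(2) face_of_imp_subset by blast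
    ultimately show False using face_of_imp_eq_affine_Int[OF cP f(1)] qE1 by blast
  qed
  then have "orient p q a < 0 \<or> orient p q b < 0" using opp by linarith
  then obtain v where v: "v = a \<or> v = b" "orient p q v < 0" by blast
  have E1v: "?E1 = closed_segment v (2 *\<^sub>R p - v)"
    using v(1) p mid2(1) by (metis closed_segment_commute midpoint_sym)
  have vx: "v extreme_point_of P"
    using extreme_point_of_face[OF f(1)] v(1) by (auto simp: extreme_point_of_segment)
  \<comment> \<open>In dimension two, a vertex is the intersection of the edges through it, hence lies on
    an edge other than the first one.\<close>
  have "{v} = \<Inter>{F. F facet_of P \<and> {v} \<subseteq> F}"
  proof (rule face_of_polyhedron)
    show "polyhedron P" using P(1) by (rule polytope_imp_polyhedron)
    show "{v} face_of P" using vx by (simp add: face_of_singleton)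
    show "{v} \<noteq> P" using P(2) by auto
  qed simp
  moreover have "2 *\<^sub>R p - v \<noteq> v" using d1 unfolding E1v by auto
  then have "?E1 \<noteq> {v}" unfolding E1v by (metis ends_in_segment(2) singletonD)
  moreover have "v \<in> ?E1" unfolding E1v by simp
  ultimately obtain F where F: "F facet_of P" "v \<in> F" "F \<noteq> ?E1" by blast
  then have Fe: "F edge_of P" using P(2) by (simp add: edge_of_def facet_of_def)
  then obtain x y where xy: "F = closed_segment x y"
    using edge_of_polytope_segment[OF P(1)] by metis
  have "v extreme_point_of F"
    using extreme_point_of_face vx F(2) Fe edge_of_def by blast
  then have "v = x \<or> v = y" unfolding xy by (simp add: extreme_point_of_segment)
  then obtain u where Fu: "F = closed_segment v (2 *\<^sub>R u - v)"
    unfolding xy using mid2(1) by (metis closed_segment_commute)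
  have "u \<noteq> p" using F(3) Fu E1v by auto
  then have "u = q" using only Fe v(2) Fu by blast
  then have "closed_segment v (2 *\<^sub>R u - v) edge_of P \<longleftrightarrow> u = p \<or> u = q" for u
    using only v(2) Fe Fu E1 E1v by auto
  then show ?thesis using that vx v(2) by blast
qed

section \<open>Convex cycles of points\<close>

text \<open>The points \<open>p 0, \<dots>, p (n - 1)\<close>, continued periodically, are the vertices of a strictly
  convex polygon in counterclockwise order: all others lie to the left of each line through two
  consecutive ones.\<close>

definition convex_cycle :: "nat \<Rightarrow> (nat \<Rightarrow> real^2) \<Rightarrow> bool" where
  "convex_cycle n p \<longleftrightarrow> (\<forall>k. p (k + n) = p k) \<and>
     (\<forall>k i. 2 \<le> i \<and> i < n \<longrightarrow> orient (p k) (p (Suc k)) (p (k + i)) > 0)"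

lemma periodic_mult:
  fixes p :: "nat \<Rightarrow> 'a"
  assumes "\<And>k. p (k + n) = p k"
  shows "p (k + n * j) = p k"
proof (induction j)
  case (Suc j)
  have "p (k + n * Suc j) = p ((k + n * j) + n)" by (simp add: algebra_simps)
  then show ?case using assms Suc by simp
qed simp

text \<open>Indices of a periodic sequence may be counted from any starting point \<open>k\<close>.\<close>

lemma periodic_from:
  fixes p :: "nat \<Rightarrow> 'a"
  assumes "\<And>k. p (k + n) = p k" "0 < n"
  obtains i where "i < n" "p j = p (k + i)"
proof -
  \<comment> \<open>This represents \<open>j - k\<close> modulo \<open>n\<close> without subtraction.\<close>
  define a where "a = j + (n - 1) * k"
  have "k + a = j + n * k" using assms(2) by (cases n) (simp_all add: a_def)
  moreover have "k + a = k + a mod n + n * (a div n)" by simp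
  ultimately have "p j = p (k + a mod n)"
    using periodic_mult[of p n, OF assms(1)] by metis
  then show ?thesis using that assms(2) by (meson mod_less_divisor)
qed

lemma convex_cycleD:
  assumes "convex_cycle n p"
  shows "p (k + n) = p k"
    and "2 \<le> i \<Longrightarrow> i < n \<Longrightarrow> orient (p k) (p (Suc k)) (p (k + i)) > 0"
  using assms by (auto simp: convex_cycle_def)

lemma convex_cycle_distinct:
  assumes "convex_cycle n p" "3 \<le> n" "0 < i" "i < n"
  shows "p k \<noteq> p (k + i)"
proof (cases "i = 1")
  case True
  have "orient (p k) (p (Suc k)) (p (k + 2)) > 0"
    by (rule convex_cycleD(2)[OF assms(1)]) (use assms(2) in auto)
  then show ?thesis using True by auto
next
  case False
  then have "orient (p k) (p (Suc k)) (p (k + i)) > 0"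
    using assms by (simp add: convex_cycle_def)
  then show ?thesis by auto
qed

lemma convex_cycle_inj:
  assumes "convex_cycle n p" "3 \<le> n"
  shows "inj_on p {..<n}"
proof (rule linorder_inj_onI')
  fix i j assume "i \<in> {..<n}" "j \<in> {..<n}" "i < j"
  then show "p i \<noteq> p j"
    using convex_cycle_distinct[OF assms, of "j - i" i] by auto
qed

lemma convex_cycle_range:
  assumes "convex_cycle n p" "3 \<le> n"
  shows "range p = p ` {..<n}"
proof -
  have "p k \<in> p ` {..<n}" for k
  proof -
    obtain i where "i < n" "p k = p (0 + i)"
      using periodic_from[of p n k 0] convex_cycleD(1)[OF assms(1)] assms(2) by auto
    then show ?thesis by auto
  qed
  then show ?thesis by blast
qed

lemma convex_cycle_edge:
  assumes p: "convex_cycle n p" "3 \<le> n"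
  shows "closed_segment (p k) (p (Suc k)) edge_of convex hull (range p)"
proof -
  let ?T = "{p k, p (Suc k)}"
  have "range p - ?T \<subseteq> {x. 0 < orient (p k) (p (Suc k)) x}"
  proof
    fix x assume x: "x \<in> range p - ?T"
    then obtain j where "x = p j" by blast
    then obtain i where i: "i < n" "x = p (k + i)"
      using periodic_from[of p n j k] p by (auto simp: convex_cycle_def)
    moreover have "i \<noteq> 0" "i \<noteq> 1" using x i(2) by (auto intro: gr0I)
    ultimately show "x \<in> {x. 0 < orient (p k) (p (Suc k)) x}"
      using p(1) by (simp add: convex_cycle_def)
  qed
  then have "convex hull (range p - ?T) \<subseteq> {x. 0 < orient (p k) (p (Suc k)) x}"
    by (rule hull_minimal) (rule convex_orient_pos)
  then have "affine hull ?T \<inter> convex hull (range p - ?T) = {}"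
    using orient_affine_hull by fastforce
  moreover have "finite (range p)" using convex_cycle_range[OF p] by simp
  ultimately have "convex hull ?T face_of convex hull (range p)"
    by (intro face_of_convex_hulls) auto
  moreover have "p k \<noteq> p (Suc k)" using convex_cycle_distinct[OF p, of 1 k] p(2) by simp
  ultimately show ?thesis by (simp add: edge_of_def segment_convex_hull aff_dim_convex_hull)
qed

lemma convex_cycle_extreme_points:
  assumes p: "convex_cycle n p" "3 \<le> n"
  shows "{v. v extreme_point_of convex hull (range p)} = range p"
proof -
  have "p k extreme_point_of convex hull (range p)" for k
    using convex_cycle_edge[OF p, of k] extreme_point_of_face extreme_point_of_segment
    unfolding edge_of_def by blast
  then show ?thesis using extreme_point_of_convex_hull by auto
qed

lemma convex_cycle_edges:
  assumes p: "convex_cycle n p" "3 \<le> n"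
  shows "{e. e edge_of convex hull (range p)} = range (\<lambda>k. closed_segment (p k) (p (Suc k)))"
proof
  show "range (\<lambda>k. closed_segment (p k) (p (Suc k))) \<subseteq> {e. e edge_of convex hull (range p)}"
    using convex_cycle_edge[OF p] by blast
next
  let ?P = "convex hull (range p)"
  have per: "p (k + n) = p k" for k using p(1) by (simp add: convex_cycle_def)
  have pos: "orient (p k) (p (Suc k)) (p (k + i)) > 0" if "2 \<le> i" "i < n" for k i
    using p(1) that by (simp add: convex_cycle_def)
  have poly: "polytope ?P" using convex_cycle_range[OF p] by (auto simp: polytope_def)
  show "{e. e edge_of ?P} \<subseteq> range (\<lambda>k. closed_segment (p k) (p (Suc k)))"
  proof
    fix e assume "e \<in> {e. e edge_of ?P}"
    then have e: "e edge_of ?P" by simp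
    obtain a b where ab: "e = closed_segment a b" "a \<noteq> b" "a \<in> range p" "b \<in> range p"
      using edge_of_polytope_segment[OF poly e] convex_cycle_extreme_points[OF p]
      by (metis mem_Collect_eq)
    obtain j l where "a = p j" "b = p l" using ab by blast
    \<comment> \<open>A predecessor of \<open>a\<close> exists for every index, also for \<open>0\<close>.\<close>
    then have "a = p (Suc (j + n - 1))" using per p(2) by simp
    then obtain k where a: "a = p (Suc k)" by blast
    obtain i where i: "i < n" "b = p (Suc k + i)"
      using periodic_from[of p n l "Suc k"] per p(2) \<open>b = p l\<close> by auto
    have "i \<noteq> 0" using i(2) a ab(2) by (auto intro: gr0I)
    then consider "i = 1" | "i = n - 1" | "2 \<le> i" "Suc i < n" using i(1) by linarith
    then show "e \<in> range (\<lambda>k. closed_segment (p k) (p (Suc k)))"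
    proof cases
      case 1
      then show ?thesis using ab(1) a i(2) by auto
    next
      case 2
      then have "Suc k + i = k + n" using p(2) by simp
      then have "b = p k" using per[of k] i(2) by metis
      then show ?thesis using ab(1) a closed_segment_commute by blast
    next
      case 3
      \<comment> \<open>The segment is a diagonal: it separates the neighbours \<open>p k\<close> and \<open>p (k + 2)\<close> of its
        endpoint \<open>a\<close>, and the face property moves one of these into the edge.\<close>
      let ?u = "p k" and ?v = "p (Suc (Suc k))"
      have "orient (p k) (p (Suc k)) (p (k + Suc i)) > 0" using 3 by (intro pos) auto
      then have u: "orient a b ?u > 0" using a i(2) by (metis add_Suc add_Suc_right orient_rotate)
      have "orient (p (Suc k)) ?v (p (Suc k + i)) > 0" using 3 by (intro pos) auto
      then have v: "orient a b ?v < 0"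
        using a i(2) by (simp add: orient_def algebra_simps)
      define r s where "r = orient a b ?u" and "s = orient a b ?v"
      define t where "t = r / (r - s)"
      define y where "y = (1 - t) *\<^sub>R ?u + t *\<^sub>R ?v"
      have rs: "r > 0" "s < 0" using u v by (auto simp: r_def s_def)
      have t: "0 < t" "t < 1" using rs by (auto simp: t_def field_simps)
      have "orient a b y = (1 - t) * r + t * s"
        by (simp add: y_def orient_affine r_def s_def)
      also have "\<dots> = 0" using rs by (simp add: t_def field_simps)
      finally obtain c where "y = (1 - c) *\<^sub>R a + c *\<^sub>R b"
        using orient_zero_line ab(2) by metis
      then have "y \<in> affine hull e"
        using mem_affine[OF affine_affine_hull, of a e b "1 - c" c] ab(1) hull_inc
        by (metis diff_add_cancel ends_in_segment)
      have "?u \<noteq> ?v" using u v by auto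
      then have y: "y \<in> open_segment ?u ?v" using t by (auto simp: y_def in_segment)
      have uv: "?u \<in> ?P" "?v \<in> ?P" by (auto intro: hull_inc)
      then have "y \<in> ?P"
        using y convex_convex_hull by (meson convex_contains_open_segment subsetD)
      have ef: "e face_of ?P" using e by (simp add: edge_of_def)
      then have "y \<in> e"
        using face_of_imp_eq_affine_Int[OF convex_convex_hull ef] \<open>y \<in> affine hull e\<close> \<open>y \<in> ?P\<close>
        by blast
      then have "?u \<in> e" using face_ofD[OF ef y] uv by blast
      then have "?u \<in> affine hull {a, b}"
        using ab(1) convex_hull_subset_affine_hull segment_convex_hull by blast
      then show ?thesis using orient_affine_hull u by fastforce
    qed
  qed
qed

lemma convex_cycle_polygon:
  assumes p: "convex_cycle n p" "3 \<le> n"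
  defines "P \<equiv> convex hull (range p)"
  shows "polytope P" "aff_dim P = 2" "card {v. v extreme_point_of P} = n"
    "card {e. e edge_of P} = n"
proof -
  note range = convex_cycle_range[OF p]
  show "polytope P" using range by (auto simp: polytope_def P_def)
  show "card {v. v extreme_point_of P} = n"
    using convex_cycle_inj[OF p] convex_cycle_extreme_points[OF p] range
    by (simp add: card_image P_def)
  let ?e = "\<lambda>k. closed_segment (p k) (p (Suc k))"
  have "?e k \<in> ?e ` {..<n}" for k
  proof -
    have "?e (k + n) = ?e k" for k
      using convex_cycleD(1)[OF p(1)] by (metis add_Suc)
    then obtain i where "i < n" "?e k = ?e (0 + i)"
      using periodic_from[of ?e n k 0] p(2) by auto
    then show ?thesis by auto
  qed
  then have edges: "{e. e edge_of P} = ?e ` {..<n}"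
    unfolding P_def convex_cycle_edges[OF p] by blast
  have "inj_on ?e {..<n}"
  proof (rule linorder_inj_onI')
    fix k j assume "k \<in> {..<n}" "j \<in> {..<n}" and kj: "k < j"
    have pos: "orient (p k) (p (Suc k)) (p (k + i)) > 0" if "2 \<le> i" "i < n" for i
      using p(1) that by (simp add: convex_cycle_def)
    \<comment> \<open>An endpoint of the side \<open>j\<close> that is not on the side \<open>k\<close>.\<close>
    define l where "l = (if j = Suc k then Suc j else j)"
    have "orient (p k) (p (Suc k)) (p (k + (l - k))) > 0"
      using kj \<open>j \<in> {..<n}\<close> p(2) by (intro pos) (auto simp: l_def)
    then have "p l \<noteq> p k" "p l \<noteq> p (Suc k)" using kj by (auto simp: l_def)
    moreover have "p l \<in> {p j, p (Suc j)}" by (simp add: l_def)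
    ultimately show "?e k \<noteq> ?e j" by auto
  qed
  then show "card {e. e edge_of P} = n" unfolding edges by (simp add: card_image)
  have e: "?e 0 face_of P" "aff_dim (?e 0) = 1"
    using convex_cycle_edge[OF p, of 0] by (auto simp: P_def edge_of_def)
  have "?e 0 \<noteq> P"
  proof
    assume "?e 0 = P"
    then have "p 2 \<in> ?e 0" by (simp add: P_def hull_inc)
    then have "p 2 \<in> affine hull {p 0, p (Suc 0)}"
      using convex_hull_subset_affine_hull segment_convex_hull by blast
    moreover have "orient (p 0) (p (Suc 0)) (p (0 + 2)) > 0"
      by (rule convex_cycleD(2)[OF p(1)]) (use p(2) in auto)
    ultimately show False
      using orient_affine_hull[of "p 2" "p 0" "p (Suc 0)"] by (simp add: numeral_2_eq_2)
  qed
  then have "aff_dim (?e 0) < aff_dim P"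
    using face_of_aff_dim_lt e(1) by (metis P_def convex_convex_hull)
  moreover have "aff_dim P \<le> 2" using aff_dim_le_DIM[of P] by simp
  ultimately show "aff_dim P = 2" using e(2) by linarith
qed

lemma convex_cycle_edge_midpoints:
  assumes p: "convex_cycle n p" "3 \<le> n"
  shows "edge_midpoints (convex hull (range p)) = range (\<lambda>k. midpoint (p k) (p (Suc k)))"
proof
  show "edge_midpoints (convex hull (range p)) \<subseteq> range (\<lambda>k. midpoint (p k) (p (Suc k)))"
  proof
    fix x assume "x \<in> edge_midpoints (convex hull (range p))"
    then obtain a b where x: "x = midpoint a b" "closed_segment a b edge_of convex hull (range p)"
      by (auto simp: edge_midpoints_def)
    then obtain k where "closed_segment a b = closed_segment (p k) (p (Suc k))"
      using convex_cycle_edges[OF p] by blast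
    then show "x \<in> range (\<lambda>k. midpoint (p k) (p (Suc k)))"
      using x(1) midpoint_eq_if_segment_eq by blast
  qed
  show "range (\<lambda>k. midpoint (p k) (p (Suc k))) \<subseteq> edge_midpoints (convex hull (range p))"
    using convex_cycle_edge[OF p] by (auto simp: edge_midpoints_def)
qed

lemma antiperiodic_convex_cycle:
  assumes anti: "\<And>k. p (k + h) = - p k" and "0 < h"
    and pos: "\<And>k i. k < h \<Longrightarrow> 2 \<le> i \<Longrightarrow> i < 2 * h \<Longrightarrow> orient (p k) (p (Suc k)) (p (k + i)) > 0"
  shows "convex_cycle (2 * h) p"
  unfolding convex_cycle_def
proof (intro conjI allI impI)
  fix k
  have "p (k + 2 * h) = p ((k + h) + h)" by (simp add: mult_2 add.assoc)
  then show "p (k + 2 * h) = p k" using anti by simp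
next
  fix k i assume i: "2 \<le> i \<and> i < 2 * h"
  show "orient (p k) (p (Suc k)) (p (k + i)) > 0"
  proof (induction k rule: less_induct)
    case (less k)
    show ?case
    proof (cases "k < h")
      case False
      then obtain l where l: "k = l + h" by (metis add.commute le_Suc_ex not_less)
      have "p k = - p l" "p (Suc k) = - p (Suc l)" "p (k + i) = - p (l + i)"
        using anti[of l] anti[of "Suc l"] anti[of "l + i"] by (simp_all add: l algebra_simps)
      then show ?thesis using less[of l] l \<open>0 < h\<close> by simp
    qed (use pos i in auto)
  qed
qed

section \<open>Polygons with prescribed edge midpoints\<close>

text \<open>The vertices of a polygon whose edges have the midpoints \<open>m 0, m 1, \<dots>\<close>, when \<open>v\<close> is the
  vertex preceding the edge with midpoint \<open>m 0\<close>: each vertex is the reflection of its predecessor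
  in the midpoint between them.\<close>

primrec vertex_seq :: "(nat \<Rightarrow> real^2) \<Rightarrow> real^2 \<Rightarrow> nat \<Rightarrow> real^2" where
  "vertex_seq m v 0 = v"
| "vertex_seq m v (Suc k) = 2 *\<^sub>R m k - vertex_seq m v k"

text \<open>For odd \<open>h\<close>, the second premise says that the alternating sum of \<open>m 0, \<dots>, m (h - 1)\<close>
  vanishes.\<close>

lemma vertex_seq_antiperiodic:
  assumes "\<And>k. m (k + h) = - m k" "vertex_seq m v h = - v"
  shows "vertex_seq m v (k + h) = - vertex_seq m v k"
  by (induction k) (simp_all add: assms)

text \<open>In a polygon whose edge midpoints form a convex cycle the edges have the cyclic order of their
  midpoints, and each vertex lies beyond the line through the midpoints of its two edges.\<close>

lemma vertices_from_midpoints: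
  assumes P: "polytope P" "aff_dim P = 2" and U: "edge_midpoints P = range m"
    and m: "convex_cycle n m" "3 \<le> n"
  obtains v where "v extreme_point_of P"
    "\<And>k. orient (m k) (m (Suc k)) (vertex_seq m v (Suc k)) < 0"
proof -
  have "\<exists>v. v extreme_point_of P \<and> orient (m k) (m (Suc k)) v < 0 \<and>
     (\<forall>u. closed_segment v (2 *\<^sub>R u - v) edge_of P \<longleftrightarrow> u = m k \<or> u = m (Suc k))" for k
  proof -
    have "m k \<noteq> m (Suc k)" using convex_cycle_distinct[OF m, of 1 k] m(2) by simp
    moreover have "orient (m k) (m (Suc k)) u > 0"
      if u: "u \<in> edge_midpoints P" "u \<noteq> m k" "u \<noteq> m (Suc k)" for u
    proof -
      obtain j where "u = m j" using u(1) U by blast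
      then obtain i where i: "i < n" "u = m (k + i)"
        using periodic_from[of m n j k] m by (auto simp: convex_cycle_def)
      moreover have "i \<noteq> 0" "i \<noteq> 1" using i(2) u by (auto intro: gr0I)
      ultimately show ?thesis using m(1) by (simp add: convex_cycle_def)
    qed
    moreover have "m k \<in> edge_midpoints P" "m (Suc k) \<in> edge_midpoints P" using U by auto
    ultimately show ?thesis
      using vertex_between_consecutive_midpoints[OF P] by metis
  qed
  then obtain f where f: "\<And>k. f k extreme_point_of P"
      "\<And>k. orient (m k) (m (Suc k)) (f k) < 0"
      "\<And>k u. closed_segment (f k) (2 *\<^sub>R u - f k) edge_of P \<longleftrightarrow> u = m k \<or> u = m (Suc k)"
    by metis
  have mid: "midpoint x (2 *\<^sub>R u - x) = u" for x u :: "real^2" by (simp add: midpoint_def)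
  have step: "f (Suc k) = 2 *\<^sub>R m (Suc k) - f k" for k
  proof -
    let ?u = "m (Suc k)"
    let ?e = "closed_segment (f k) (2 *\<^sub>R ?u - f k)"
    let ?e' = "closed_segment (f (Suc k)) (2 *\<^sub>R ?u - f (Suc k))"
    have "?e edge_of P" "?e' edge_of P" using f(3) by auto
    moreover from this have "?e = ?e'"
      using edge_eq_if_midpoint_in[OF polytope_imp_convex[OF P(1)]] mid midpoint_in_closed_segment
      by metis
    \<comment> \<open>The edge with midpoint \<open>m k\<close> ends in \<open>f k\<close>, but not in \<open>f (Suc k)\<close>.\<close>
    moreover have "f k \<noteq> f (Suc k)"
    proof
      assume "f k = f (Suc k)"
      then have "m k = m (Suc k) \<or> m k = m (Suc (Suc k))" using f(3) by metis
      then show False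
        using convex_cycle_distinct[OF m, of 1 k] convex_cycle_distinct[OF m, of 2 k] m(2) by auto
    qed
    ultimately show ?thesis by (auto simp: doubleton_eq_iff)
  qed
  define v where "v = 2 *\<^sub>R m 0 - f 0"
  have seq: "vertex_seq m v (Suc k) = f k" for k
    by (induction k) (simp_all add: v_def step)
  have "closed_segment (f 0) v edge_of P" using f(3) by (simp add: v_def)
  then have "v extreme_point_of P"
    using extreme_point_of_face extreme_point_of_segment unfolding edge_of_def by blast
  moreover have "orient (m k) (m (Suc k)) (vertex_seq m v (Suc k)) < 0" for k
    using f(2) seq by simp
  ultimately show ?thesis using that by blast
qed

text \<open>Here the antiperiodicity of \<open>m\<close> and of the vertex sequence makes the origin the centre.\<close>

lemma polygon_from_vertices:
  assumes anti: "\<And>k. m (k + 5) = - m k" "vertex_seq m v 5 = - v"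
    and cyc: "convex_cycle 10 (vertex_seq m v)"
  shows "\<exists>P. convex_decagon P \<and> centrally_symmetric P \<and> v extreme_point_of P \<and>
    edge_midpoints P = range m"
proof (intro exI conjI)
  let ?w = "vertex_seq m v"
  let ?P = "convex hull (range ?w)"
  have le: "3 \<le> (10::nat)" by simp
  show "convex_decagon ?P"
    using convex_cycle_polygon[OF cyc le] by (simp add: convex_decagon_def)
  have "?w 0 \<in> {v. v extreme_point_of ?P}"
    unfolding convex_cycle_extreme_points[OF cyc le] by (rule rangeI)
  then show "v extreme_point_of ?P" by simp
  have "midpoint (?w k) (?w (Suc k)) = m k" for k by (simp add: midpoint_def)
  then show "edge_midpoints ?P = range m"
    using convex_cycle_edge_midpoints[OF cyc le] by simp
  have "uminus ` range ?w = range ?w"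
  proof -
    have neg: "- ?w k \<in> range ?w" for k
      unfolding vertex_seq_antiperiodic[OF anti, of k, symmetric] by (rule rangeI)
    then have "?w k \<in> uminus ` range ?w" for k
      by (intro image_eqI[of _ _ "- ?w k"]) simp_all
    then show ?thesis using neg by auto
  qed
  then have "uminus ` ?P = ?P"
    using convex_hull_linear_image[OF linear_uminus, of "range ?w"] by simp
  then have "(\<lambda>x. 2 *\<^sub>R 0 - x) ` ?P = ?P" by simp
  then show "centrally_symmetric ?P" unfolding centrally_symmetric_def by blast
qed

section \<open>The two families of midpoints\<close>

text \<open>The sequence that repeats the list \<open>xs\<close>, with the opposite sign in every second
  repetition.\<close>

definition alternating_seq :: "'a::real_vector list \<Rightarrow> nat \<Rightarrow> 'a" where
  "alternating_seq xs k = (- 1) ^ (k div length xs) *\<^sub>R xs ! (k mod length xs)"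

lemma alternating_seq_antiperiodic:
  assumes "length xs = h" "0 < h"
  shows "alternating_seq xs (k + h) = - alternating_seq xs k"
  using assms by (simp add: alternating_seq_def)

lemma range_alternating_seq:
  assumes "xs \<noteq> []"
  shows "range (alternating_seq xs) = set xs \<union> uminus ` set xs"
proof
  show "range (alternating_seq xs) \<subseteq> set xs \<union> uminus ` set xs"
  proof
    fix x assume "x \<in> range (alternating_seq xs)"
    then obtain k where k: "x = alternating_seq xs k" by blast
    have "xs ! (k mod length xs) \<in> set xs" using assms by simp
    then show "x \<in> set xs \<union> uminus ` set xs"
      unfolding k alternating_seq_def by (cases "even (k div length xs)") auto
  qed
next
  have "xs ! i \<in> range (alternating_seq xs) \<and> - (xs ! i) \<in> range (alternating_seq xs)"
    if "i < length xs" for i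
  proof -
    have "xs ! i = alternating_seq xs i" using that by (simp add: alternating_seq_def)
    then show ?thesis
      using alternating_seq_antiperiodic[OF refl, of xs i] assms by (metis length_greater_0_conv rangeI)
  qed
  then show "set xs \<union> uminus ` set xs \<subseteq> range (alternating_seq xs)"
    by (auto simp: in_set_conv_nth)
qed

lemma vertex_seq_numeral [simp]:
  "vertex_seq m v (numeral k) = 2 *\<^sub>R m (pred_numeral k) - vertex_seq m v (pred_numeral k)"
  by (simp add: numeral_eq_Suc)

text \<open>The two families of midpoints, listed counterclockwise. The list starts with the midpoint of
  the edge that follows the vertex in the quadrilateral; the alternating sum of its entries is
  zero.\<close>

definition seq_a :: "nat \<Rightarrow> real^2" where
  "seq_a = alternating_seq [vector [-1, 1/2], - vector [2, 0], - vector [2, 1/2],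
     - vector [3/2, 1], - vector [1/2, 1]]"

definition seq_b :: "nat \<Rightarrow> real^2" where
  "seq_b = alternating_seq [- vector [1/2, -1], - vector [3/2, -1/2], - vector [2, 0],
     - vector [3/2, 1/2], - vector [1/2, 1]]"

lemma seq_antiperiodic: "seq_a (k + 5) = - seq_a k" "seq_b (k + 5) = - seq_b k"
  unfolding seq_a_def seq_b_def by (simp_all add: alternating_seq_antiperiodic)

lemma range_seq_a: "range seq_a = midpoints_a"
  by (simp add: seq_a_def range_alternating_seq midpoints_a_def half_midpoints_a_def) blast

lemma range_seq_b: "range seq_b = midpoints_b"
  by (simp add: seq_b_def range_alternating_seq midpoints_b_def half_midpoints_b_def) blast

lemma seq_a_eval:
  "seq_a 0 = vector [-1, 1/2]" "seq_a (Suc 0) = - vector [2, 0]" "seq_a 2 = - vector [2, 1/2]"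
  "seq_a 3 = - vector [3/2, 1]" "seq_a 4 = - vector [1/2, 1]"
  "seq_a 5 = - vector [-1, 1/2]" "seq_a 6 = vector [2, 0]" "seq_a 7 = vector [2, 1/2]"
  "seq_a 8 = vector [3/2, 1]" "seq_a 9 = vector [1/2, 1]"
  "seq_a 10 = vector [-1, 1/2]" "seq_a 11 = - vector [2, 0]" "seq_a 12 = - vector [2, 1/2]"
  "seq_a 13 = - vector [3/2, 1]"
  by (simp_all add: seq_a_def alternating_seq_def)

lemma seq_b_eval:
  "seq_b 0 = - vector [1/2, -1]" "seq_b (Suc 0) = - vector [3/2, -1/2]" "seq_b 2 = - vector [2, 0]"
  "seq_b 3 = - vector [3/2, 1/2]" "seq_b 4 = - vector [1/2, 1]"
  "seq_b 5 = vector [1/2, -1]" "seq_b 6 = vector [3/2, -1/2]" "seq_b 7 = vector [2, 0]"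
  "seq_b 8 = vector [3/2, 1/2]" "seq_b 9 = vector [1/2, 1]"
  "seq_b 10 = - vector [1/2, -1]" "seq_b 11 = - vector [3/2, -1/2]" "seq_b 12 = - vector [2, 0]"
  "seq_b 13 = - vector [3/2, 1/2]"
  by (simp_all add: seq_b_def alternating_seq_def)

lemma vertex_seq_closes: "vertex_seq seq_a v 5 = - v" "vertex_seq seq_b v 5 = - v"
  by (simp_all add: seq_a_eval seq_b_eval vec_eq_iff forall_2)

text \<open>Explicit sets in the premises allow case distinctions over all indices: by central symmetry,
  40 orientations suffice.\<close>

lemma convex_cycle_10I:
  assumes "\<And>k. p (k + 5) = - p k"
    and "\<And>k i. k \<in> {0, 1, 2, 3, 4} \<Longrightarrow> i \<in> {2, 3, 4, 5, 6, 7, 8, 9} \<Longrightarrow>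
      orient (p k) (p (Suc k)) (p (k + i)) > 0"
  shows "convex_cycle 10 p"
proof -
  have "orient (p k) (p (Suc k)) (p (k + i)) > 0" if "k < 5" "2 \<le> i" "i < 2 * 5" for k i
  proof (rule assms(2))
    show "k \<in> {0, 1, 2, 3, 4}" using that(1) by auto
    show "i \<in> {2, 3, 4, 5, 6, 7, 8, 9}" using that(2,3) by auto
  qed
  then have "convex_cycle (2 * 5) p" by (intro antiperiodic_convex_cycle assms(1)) auto
  then show ?thesis by simp
qed

lemma convex_cycle_seq_a: "convex_cycle 10 seq_a"
  by (rule convex_cycle_10I, rule seq_antiperiodic,
      elim insertE emptyE; hypsubst; simp add: seq_a_eval orient_def flip: numeral_2_eq_2)

lemma convex_cycle_seq_b: "convex_cycle 10 seq_b"
  by (rule convex_cycle_10I, rule seq_antiperiodic,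
      elim insertE emptyE; hypsubst; simp add: seq_b_eval orient_def flip: numeral_2_eq_2)

lemma interior_quadrilateral_a:
  "v \<in> interior quadrilateral_a \<longleftrightarrow>
     v$1 < 0 \<and> v$2 > 5/6 + v$1 / 3 \<and> v$2 > 1/2 - v$1 \<and> v$2 < 1 + v$1 / 2"
proof -
  have "quadrilateral_a =
      convex hull {vector [-1/3, 5/6], vector [-1/4, 3/4], vector [0, 5/6], vector [0, 1]}"
    unfolding quadrilateral_a_def by (rule arg_cong[where f = "(hull) convex"]) blast
  then show ?thesis
    by (elim ssubst, subst interior_quadrilateral) (auto simp: orient_def field_simps)
qed

lemma interior_quadrilateral_b:
  "v \<in> interior quadrilateral_b \<longleftrightarrow>
     v$2 < 5/4 - v$1 / 2 \<and> v$2 < 5/4 + v$1 / 2 \<and> v$2 > 1 + v$1 \<and> v$2 > 1 - v$1"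
proof -
  have "quadrilateral_b =
      convex hull {vector [-1/6, 7/6], vector [0, 1], vector [1/6, 7/6], vector [0, 5/4]}"
    unfolding quadrilateral_b_def by (rule arg_cong[where f = "(hull) convex"]) blast
  then show ?thesis
    by (elim ssubst, subst interior_quadrilateral) (auto simp: orient_def field_simps)
qed

text \<open>Consecutive vertices have the form \<open>c + v\<close> and \<open>d - v\<close>, so one of them differs by a constant
  from any third vertex. Hence every orientation is affine in \<open>v\<close>, and a linear
  consequence of the inequalities for the quadrilateral.\<close>

lemma convex_cycle_vertices_a:
  assumes "v \<in> interior quadrilateral_a"
  shows "convex_cycle 10 (vertex_seq seq_a v)"
  using assms unfolding interior_quadrilateral_a
  by (intro convex_cycle_10I vertex_seq_antiperiodic seq_antiperiodic vertex_seq_closes)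
    (elim insertE emptyE; hypsubst;
      simp add: seq_a_eval orient_def algebra_simps flip: numeral_2_eq_2; linarith)

lemma convex_cycle_vertices_b:
  assumes "v \<in> interior quadrilateral_b"
  shows "convex_cycle 10 (vertex_seq seq_b v)"
  using assms unfolding interior_quadrilateral_b
  by (intro convex_cycle_10I vertex_seq_antiperiodic seq_antiperiodic vertex_seq_closes)
    (elim insertE emptyE; hypsubst;
      simp add: seq_b_eval orient_def algebra_simps flip: numeral_2_eq_2; linarith)

lemma vertex_in_quadrilateral_a:
  assumes "\<And>k. orient (seq_a k) (seq_a (Suc k)) (vertex_seq seq_a v (Suc k)) < 0"
  shows "v \<in> interior quadrilateral_a"
  using assms[of 0] assms[of 1] assms[of 2] assms[of 3] assms[of 4]
  unfolding interior_quadrilateral_a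
  by (-, intro conjI; simp add: seq_a_eval orient_def field_simps flip: numeral_2_eq_2)

lemma vertex_in_quadrilateral_b:
  assumes "\<And>k. orient (seq_b k) (seq_b (Suc k)) (vertex_seq seq_b v (Suc k)) < 0"
  shows "v \<in> interior quadrilateral_b"
  using assms[of 0] assms[of 1] assms[of 2] assms[of 3] assms[of 4]
  unfolding interior_quadrilateral_b
  by (-, intro conjI; simp add: seq_b_eval orient_def field_simps flip: numeral_2_eq_2)

theorem theorem2:
  shows
    "(\<forall>P. convex_decagon P \<and> centrally_symmetric P \<and> edge_midpoints P = midpoints_a
        \<longrightarrow> (\<exists>v. v extreme_point_of P \<and> v \<in> interior quadrilateral_a)) \<and>
     (\<forall>v \<in> interior quadrilateral_a.
        \<exists>P. convex_decagon P \<and> centrally_symmetric P \<and> v extreme_point_of P \<and>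
            edge_midpoints P = midpoints_a) \<and>
     (\<forall>P. convex_decagon P \<and> centrally_symmetric P \<and> edge_midpoints P = midpoints_b
        \<longrightarrow> (\<exists>v. v extreme_point_of P \<and> v \<in> interior quadrilateral_b)) \<and>
     (\<forall>v \<in> interior quadrilateral_b.
        \<exists>P. convex_decagon P \<and> centrally_symmetric P \<and> v extreme_point_of P \<and>
            edge_midpoints P = midpoints_b)"
proof (intro conjI allI ballI impI)
  fix P assume "convex_decagon P \<and> centrally_symmetric P \<and> edge_midpoints P = midpoints_a"
  then have "polytope P" "aff_dim P = 2" "edge_midpoints P = range seq_a"
    by (simp_all add: convex_decagon_def range_seq_a)
  then obtain v where "v extreme_point_of P"
      "\<And>k. orient (seq_a k) (seq_a (Suc k)) (vertex_seq seq_a v (Suc k)) < 0"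
    using vertices_from_midpoints[OF _ _ _ convex_cycle_seq_a] by auto
  then show "\<exists>v. v extreme_point_of P \<and> v \<in> interior quadrilateral_a"
    using vertex_in_quadrilateral_a by blast
next
  fix v assume "v \<in> interior quadrilateral_a"
  then show "\<exists>P. convex_decagon P \<and> centrally_symmetric P \<and> v extreme_point_of P \<and>
      edge_midpoints P = midpoints_a"
    using polygon_from_vertices[OF seq_antiperiodic(1) vertex_seq_closes(1)]
      convex_cycle_vertices_a range_seq_a by simp
next
  fix P assume "convex_decagon P \<and> centrally_symmetric P \<and> edge_midpoints P = midpoints_b"
  then have "polytope P" "aff_dim P = 2" "edge_midpoints P = range seq_b"
    by (simp_all add: convex_decagon_def range_seq_b)
  then obtain v where "v extreme_point_of P"
      "\<And>k. orient (seq_b k) (seq_b (Suc k)) (vertex_seq seq_b v (Suc k)) < 0"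
    using vertices_from_midpoints[OF _ _ _ convex_cycle_seq_b] by auto
  then show "\<exists>v. v extreme_point_of P \<and> v \<in> interior quadrilateral_b"
    using vertex_in_quadrilateral_b by blast
next
  fix v assume "v \<in> interior quadrilateral_b"
  then show "\<exists>P. convex_decagon P \<and> centrally_symmetric P \<and> v extreme_point_of P \<and>
      edge_midpoints P = midpoints_b"
    using polygon_from_vertices[OF seq_antiperiodic(2) vertex_seq_closes(2)]
      convex_cycle_vertices_b range_seq_b by simp
qed

end
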